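(* Let $0\le k\le n$ and let $\mathcal{F}_k$ be a class of functions $\{0,1\}^n\to\{\pm1\}$ such that the maximum sensitivity of any function in $\mathcal{F}_k$ is upper bounded by $k$. Let $S=(x^{(1)},\dots,x^{(m)})$ be a sample of $m$ points drawn independently and uniformly at random from $\{0,1\}^n$. For any $\delta>0$, with probability at least $1-\delta$, the following holds for any functions $f,\hat f\in\mathcal{F}_k$: $$L(\hat f,f)\;\le\;\hat L_S(\hat f,f)+\sqrt{\frac{c\,n^{2k}\log\frac{2em}{c\,n^{2k}}+8\log\frac{4}{\delta}}{m}},$$ where $c>0$ is some constant.
   Context: For $x\in\{0,1\}^n$ and $i\in\{1,\dots,n\}$, let $x^{\oplus i}=(x_1,\dots,x_{i-1},1-x_i,x_{i+1},\dots,x_n)$ be $x$ with its $i$-th bit flipped. The sensitivity of $f:\{0,1\}^n\to\{\pm1\}$ at $x$ is $s(f,x)=\sum_{i=1}^n\mathbb{I}[f(x)\ne f(x^{\oplus i})]$, where $\mathbb{I}$ is the indicator function, and the maximum sensitivity of $f$ is $ms(f)=\max_{x\in\{0,1\}^n}s(f,x)$. Here $f\in\mathcal{F}_k$ is a target function and $\hat f\in\mathcal{F}_k$ is a hypothesis produced by a learning algorithm. The true error is $L(\hat f,f)=\mathbb{E}_{x\sim\{0,1\}^n}\big[\mathbb{I}[\hat f(x)\ne f(x)]\big]$, with $x$ uniform on $\{0,1\}^n$, and the empirical error on the sample $S=(x^{(1)},\dots,x^{(m)})$ is $\hat L_S(\hat f,f)=\frac1m\sum_{i=1}^m\mathbb{I}[\hat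 f(x^{(i)})\ne f(x^{(i)})]$. The number $e$ is the base of the natural logarithm.
   Formalization: The bound is proved under the added condition c n^{2k} ≤ 2m, with c an absolute constant; without it the claim fails, e.g. for k=n, all functions, m=1, δ=1/2 and n large, where the quantity under the square root is negative. *)

theory Defs
  imports "HOL-Probability.Probability"
begin

definition cube :: "nat \<Rightarrow> (nat \<Rightarrow> nat) set" where
  "cube n = {1..n} \<rightarrow>\<^sub>E {0, 1}"

definition flip :: "(nat \<Rightarrow> nat) \<Rightarrow> nat \<Rightarrow> (nat \<Rightarrow> nat)" where
  "flip x i = x(i := 1 - x i)"

definition sensitivity :: "nat \<Rightarrow> ((nat \<Rightarrow> nat) \<Rightarrow> int) \<Rightarrow> (nat \<Rightarrow> nat) \<Rightarrow> nat" where
  "sensitivity n f x = (\<Sum>i = 1..n. of_bool (f x \<noteq> f (flip x i)))"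

definition max_sensitivity :: "nat \<Rightarrow> ((nat \<Rightarrow> nat) \<Rightarrow> int) \<Rightarrow> nat" where
  "max_sensitivity n f = Max (sensitivity n f ` cube n)"

definition true_error ::
  "nat \<Rightarrow> ((nat \<Rightarrow> nat) \<Rightarrow> int) \<Rightarrow> ((nat \<Rightarrow> nat) \<Rightarrow> int) \<Rightarrow> real" where
  "true_error n g f =
     measure_pmf.expectation (pmf_of_set (cube n)) (\<lambda>x. of_bool (g x \<noteq> f x))"

definition empirical_error ::
  "nat \<Rightarrow> (nat \<Rightarrow> nat \<Rightarrow> nat) \<Rightarrow> ((nat \<Rightarrow> nat) \<Rightarrow> int) \<Rightarrow> ((nat \<Rightarrow> nat) \<Rightarrow> int) \<Rightarrow> real" where
  "empirical_error m S g f = (1 / real m) * (\<Sum>i = 1..m. of_bool (g (S i) \<noteq> f (S i)))"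

text \<open>The law of a sample of \<open>m\<close> independent uniform points. Samples are functions on
  \<open>{1..m}\<close>, and \<open>undefined\<close> is only the value outside that index set.\<close>

definition sample_pmf :: "nat \<Rightarrow> nat \<Rightarrow> (nat \<Rightarrow> nat \<Rightarrow> nat) pmf" where
  "sample_pmf n m = Pi_pmf {1..m} undefined (\<lambda>_. pmf_of_set (cube n))"

text \<open>Finiteness and nonemptiness of the cube make the uses of \<open>Max\<close> and
  \<open>pmf_of_set\<close> above meaningful.\<close>

lemma finite_cube: "finite (cube n)"
  unfolding cube_def by (intro finite_PiE) auto

lemma cube_nonempty: "cube n \<noteq> {}"
  by (simp add: cube_def PiE_eq_empty_iff)

lemma flip_in_cube: "x \<in> cube n \<Longrightarrow> i \<in> {1..n} \<Longrightarrow> flip x i \<in> cube n"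
  by (auto simp: cube_def flip_def PiE_iff extensional_def)

end

theory Submission
  imports Defs
begin

text \<open>
  A function of sensitivity at most \<open>k\<close> is determined by its values on the Hamming ball of
  radius \<open>2 * k\<close> around the origin: a point of weight above \<open>2 * k\<close> has more than \<open>2 * k\<close>
  neighbours of smaller weight, and each of two such functions changes its value at no more than
  \<open>k\<close> of them, so the two functions agree at the point if they agree at all of these neighbours.
  The class therefore has at most \<open>2 ^ (n ^ (2 * k) + 1)\<close> elements, and Hoeffding's inequality
  with a union bound over pairs of functions gives the estimate: the lower bound on \<open>m\<close> makes the logarithm at
  least 1, so its term alone outweighs the number of pairs.
\<close>

section \<open>Low sensitivity and Hamming balls\<close>

definition weight :: "nat \<Rightarrow> (nat \<Rightarrow> nat) \<Rightarrow> nat" where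
  "weight n x = card {i \<in> {1..n}. x i = 1}"

definition hamming_ball :: "nat \<Rightarrow> nat \<Rightarrow> (nat \<Rightarrow> nat) set" where
  "hamming_ball n r = {x \<in> cube n. weight n x \<le> r}"

lemma sensitivity_eq_card:
  "sensitivity n f x = card {i \<in> {1..n}. f x \<noteq> f (flip x i)}"
  by (simp add: sensitivity_def sum.If_cases Int_def)

lemma sensitivity_le_max_sensitivity:
  "x \<in> cube n \<Longrightarrow> sensitivity n f x \<le> max_sensitivity n f"
  unfolding max_sensitivity_def by (intro Max_ge) (auto simp: finite_cube)

lemma weight_flip_less:
  assumes "i \<in> {1..n}" "x i = 1"
  shows "weight n (flip x i) < weight n x"
  unfolding weight_def flip_def by (rule psubset_card_mono) (use assms in auto)

lemma eq_on_cube_if_eq_on_hamming_ball: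
  assumes f: "max_sensitivity n f \<le> k" and g: "max_sensitivity n g \<le> k"
    and eq: "\<And>x. x \<in> hamming_ball n (2 * k) \<Longrightarrow> f x = g x"
    and "x \<in> cube n"
  shows "f x = g x"
  using \<open>x \<in> cube n\<close>
proof (induction "weight n x" arbitrary: x rule: less_induct)
  case less
  show ?case
  proof (cases "weight n x \<le> 2 * k")
    case True
    then show ?thesis using eq less.prems by (simp add: hamming_ball_def)
  next
    case False
    define A where "A = {i \<in> {1..n}. f x \<noteq> f (flip x i)}"
    define B where "B = {i \<in> {1..n}. g x \<noteq> g (flip x i)}"
    have "card A \<le> k" "card B \<le> k"
      using sensitivity_le_max_sensitivity[OF less.prems, of f] f
        sensitivity_le_max_sensitivity[OF less.prems, of g] g
      by (simp_all add: A_def B_def sensitivity_eq_card)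
    then have "card (A \<union> B) < card {i \<in> {1..n}. x i = 1}"
      using False card_Un_le[of A B] by (simp add: weight_def)
    moreover have "finite (A \<union> B)"
      by (simp add: A_def B_def)
    \<comment> \<open>By counting, some coordinate \<open>i\<close> carries a 1 and is sensitive for
      neither function; flipping it lowers the weight and changes neither value, so the induction
      hypothesis applies.\<close>
    ultimately have "\<not> {i \<in> {1..n}. x i = 1} \<subseteq> A \<union> B"
      by (metis card_mono leD)
    then obtain i where i: "i \<in> {1..n}" "x i = 1" and "f x = f (flip x i)" "g x = g (flip x i)"
      by (auto simp: A_def B_def)
    then show ?thesis
      using less.hyps[OF weight_flip_less[where x = x, OF i] flip_in_cube[OF less.prems i(1)]] by simp
  qed
qed

text \<open>A point of the cube is determined by its support, and a nonempty support of size at most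
  \<open>r\<close> is the set of entries of some list of length \<open>r\<close> over
  \<open>{1..n}\<close>. The summand 1 accounts for the origin, whose support is empty.\<close>

lemma card_hamming_ball_le: "card (hamming_ball n r) \<le> n ^ r + 1"
proof -
  define L where "L = {xs. set xs \<subseteq> {1..n} \<and> length xs = r}"
  define ind :: "nat set \<Rightarrow> nat \<Rightarrow> nat" where
    "ind A = restrict (\<lambda>i. of_bool (i \<in> A)) {1..n}" for A
  have fin: "finite L" and card: "card L = n ^ r"
    by (simp_all add: L_def finite_lists_length_eq card_lists_length_eq)
  have "hamming_ball n r \<subseteq> insert (ind {}) ((ind \<circ> set) ` L)"
  proof
    fix x assume x: "x \<in> hamming_ball n r"
    define A where "A = {i \<in> {1..n}. x i = 1}"
    have xA: "x = ind A"
    proof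
      fix i
      show "x i = ind A i"
        using x by (cases "i \<in> {1..n}")
          (auto simp: hamming_ball_def cube_def ind_def A_def PiE_iff extensional_def)
    qed
    show "x \<in> insert (ind {}) ((ind \<circ> set) ` L)"
    proof (cases "A = {}")
      case True
      then show ?thesis using xA by simp
    next
      case False
      obtain xs where xs: "set xs = A" "length xs = card A"
        using finite_distinct_list[of A] distinct_card by (fastforce simp: A_def)
      \<comment> \<open>padding by a repeated element gives a list of length exactly \<open>r\<close>\<close>
      define ys where "ys = replicate (r - card A) (hd xs) @ xs"
      have "card A \<le> r"
        using x by (simp add: hamming_ball_def weight_def A_def)
      moreover have "hd xs \<in> A"
        using False xs(1) by (metis hd_in_set set_empty)
      ultimately have "set ys = A" "length ys = r"
        using xs by (auto simp: ys_def)
      moreover have "A \<subseteq> {1..n}"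
        by (auto simp: A_def)
      ultimately have "ys \<in> L" "x = (ind \<circ> set) ys"
        using xA by (simp_all add: L_def)
      then show ?thesis by blast
    qed
  qed
  then have "card (hamming_ball n r) \<le> card (insert (ind {}) ((ind \<circ> set) ` L))"
    using fin by (intro card_mono) auto
  also have "\<dots> \<le> card L + 1"
    using card_image_le[OF fin, of "ind \<circ> set"] by (simp add: card_insert_if fin)
  finally show ?thesis by (simp add: card)
qed

text \<open>Restriction to the Hamming ball of radius \<open>2 * k\<close> is injective on
  \<open>F\<close>, so there are at most as many functions as sign patterns on the ball.\<close>

lemma bounded_sensitivity_class_card:
  fixes F :: "((nat \<Rightarrow> nat) \<Rightarrow> int) set"
  assumes F: "F \<subseteq> cube n \<rightarrow>\<^sub>E {-1, 1}" and sens: "\<And>f. f \<in> F \<Longrightarrow> max_sensitivity n f \<le> k"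
  shows "finite F" "card F \<le> 2 ^ (n ^ (2 * k) + 1)"
proof -
  show "finite F"
    by (rule finite_subset[OF F]) (simp add: finite_PiE finite_cube)
  let ?B = "hamming_ball n (2 * k)"
  have finB: "finite ?B" by (simp add: hamming_ball_def finite_cube)
  have "inj_on (\<lambda>f. restrict f ?B) F"
  proof (rule inj_onI)
    fix f g assume fg: "f \<in> F" "g \<in> F" and "restrict f ?B = restrict g ?B"
    then have "f x = g x" if "x \<in> ?B" for x
      using that by (metis restrict_apply')
    then have "f x = g x" if "x \<in> cube n" for x
      using eq_on_cube_if_eq_on_hamming_ball sens fg that by blast
    \<comment> \<open>Members of \<open>F\<close> are extensional, so agreement on the cube is
      equality.\<close>
    then show "f = g"
      using F fg by (intro PiE_ext[of f "cube n" "\<lambda>_. {-1, 1}" g]) auto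
  qed
  moreover have "(\<lambda>f. restrict f ?B) ` F \<subseteq> ?B \<rightarrow>\<^sub>E {-1, 1}"
    using F by (fastforce simp: hamming_ball_def PiE_iff)
  ultimately have "card F \<le> card (?B \<rightarrow>\<^sub>E {-1, 1 :: int})"
    by (rule card_inj_on_le) (simp add: finB finite_PiE)
  also have "\<dots> = 2 ^ card ?B"
    by (simp add: card_PiE finB) (simp only: numeral_2_eq_2)
  also have "\<dots> \<le> 2 ^ (n ^ (2 * k) + 1)"
    by (intro power_increasing card_hamming_ball_le) auto
  finally show "card F \<le> 2 ^ (n ^ (2 * k) + 1)" .
qed

section \<open>Concentration of the empirical error\<close>

lemma Pi_pmf_Hoeffding_lower:
  fixes p :: "'a pmf" and h :: "'a \<Rightarrow> real"
  assumes h: "\<And>x. h x \<in> {0..1}" and I: "finite I" "I \<noteq> {}" and t: "t \<ge> 0"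
  shows "measure_pmf.prob (Pi_pmf I d (\<lambda>_. p))
           {S. (\<Sum>i\<in>I. h (S i)) \<le> real (card I) * (measure_pmf.expectation p h - t)}
         \<le> exp (- 2 * real (card I) * t\<^sup>2)"
proof -
  let ?P = "Pi_pmf I d (\<lambda>_. p)"
  interpret Hoeffding_ineq ?P I "\<lambda>i S. h (S i)" "\<lambda>_. 0" "\<lambda>_. 1"
    "\<Sum>i\<in>I. measure_pmf.expectation ?P (\<lambda>S. h (S i))"
  proof unfold_locales
    show "prob_space.indep_vars ?P (\<lambda>_. borel) (\<lambda>i S. h (S i)) I"
      by (rule prob_space.indep_vars_compose2[OF _ indep_vars_Pi_pmf])
        (auto simp: I prob_space_measure_pmf)
  qed (use h I in auto)
  \<comment> \<open>Each coordinate of the product law has marginal \<open>p\<close>, so all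
    summands share one mean.\<close>
  have "measure_pmf.expectation ?P (\<lambda>S. h (S i)) = measure_pmf.expectation p h" if "i \<in> I" for i
  proof -
    have "measure_pmf.expectation ?P (\<lambda>S. h (S i)) =
          measure_pmf.expectation (map_pmf (\<lambda>S. S i) ?P) h"
      by simp
    then show ?thesis
      using that I by (simp add: Pi_pmf_component del: integral_map_pmf)
  qed
  then have "(\<Sum>i\<in>I. measure_pmf.expectation ?P (\<lambda>S. h (S i)))
             = real (card I) * measure_pmf.expectation p h"
    by simp
  moreover have "card I > 0"
    using I by (simp add: card_gt_0_iff)
  \<comment> \<open>A deviation of \<open>card I * t\<close> for \<open>card I\<close> variables of
    range 1 has Hoeffding exponent \<open>2 * (card I * t)\<^sup>2 / card I\<close>.\<close>
  ultimately show ?thesis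
    using Hoeffding_ineq_le[of "real (card I) * t"] t
    by (simp add: algebra_simps power2_eq_square)
qed

lemma prob_true_error_exceeds:
  assumes "m > 0" "t \<ge> 0"
  shows "measure_pmf.prob (sample_pmf n m)
           {S. true_error n g f > empirical_error m S g f + t} \<le> exp (- 2 * real m * t\<^sup>2)"
proof -
  let ?h = "\<lambda>x. of_bool (g x \<noteq> f x) :: real"
  have "measure_pmf.prob (sample_pmf n m)
           {S. true_error n g f > empirical_error m S g f + t}
      \<le> measure_pmf.prob (sample_pmf n m) {S. (\<Sum>i\<in>{1..m}. ?h (S i)) \<le>
          real (card {1..m}) * (measure_pmf.expectation (pmf_of_set (cube n)) ?h - t)}"
    using \<open>m > 0\<close>
    by (intro measure_pmf.finite_measure_mono)
      (auto simp: true_error_def empirical_error_def field_simps simp del: of_bool_eq_iff)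
  also have "\<dots> \<le> exp (- 2 * real (card {1..m}) * t\<^sup>2)"
    unfolding sample_pmf_def by (rule Pi_pmf_Hoeffding_lower) (use assms in auto)
  finally show ?thesis by simp
qed

text \<open>This is the union bound over the \<open>(card F)\<^sup>2\<close> ordered pairs, followed
  by passing to the complement.\<close>

lemma uniform_deviation_bound:
  fixes F :: "((nat \<Rightarrow> nat) \<Rightarrow> int) set"
  assumes "finite F" "m > 0" "t \<ge> 0"
  shows "measure_pmf.prob (sample_pmf n m)
           {S. \<forall>f\<in>F. \<forall>g\<in>F. true_error n g f \<le> empirical_error m S g f + t}
         \<ge> 1 - (real (card F))\<^sup>2 * exp (- 2 * real m * t\<^sup>2)"
proof -
  let ?P = "sample_pmf n m"
  define bad where
    "bad = (\<lambda>(f, g). {S. true_error n g f > empirical_error m S g f + t})"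
  have "measure_pmf.prob ?P (\<Union> (bad ` (F \<times> F)))
        \<le> (\<Sum>p\<in>F \<times> F. measure_pmf.prob ?P (bad p))"
    by (rule measure_UNION_le) (use assms in auto)
  also have "\<dots> \<le> (\<Sum>p\<in>F \<times> F. exp (- 2 * real m * t\<^sup>2))"
    by (rule sum_mono) (auto simp only: bad_def split: prod.splits
        intro!: prob_true_error_exceeds assms)
  also have "\<dots> = (real (card F))\<^sup>2 * exp (- 2 * real m * t\<^sup>2)"
    by (simp add: card_cartesian_product power2_eq_square)
  finally have "measure_pmf.prob ?P (\<Union> (bad ` (F \<times> F)))
        \<le> (real (card F))\<^sup>2 * exp (- 2 * real m * t\<^sup>2)" .
  moreover have "{S. \<forall>f\<in>F. \<forall>g\<in>F. true_error n g f \<le> empirical_error m S g f + t}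
      = space ?P - \<Union> (bad ` (F \<times> F))"
    by (auto simp: bad_def simp flip: not_le)
  ultimately show ?thesis
    using measure_pmf.prob_compl[of "\<Union> (bad ` (F \<times> F))" ?P] by simp
qed

theorem propositionD1:
  "\<exists>c::real. c > 0 \<and>
     (\<forall>(n::nat) (k::nat) (F :: ((nat \<Rightarrow> nat) \<Rightarrow> int) set) (m::nat) (\<delta>::real).
        k \<le> n \<longrightarrow>
        F \<subseteq> (cube n \<rightarrow>\<^sub>E {-1, 1}) \<longrightarrow>
        (\<forall>f\<in>F. max_sensitivity n f \<le> k) \<longrightarrow>
        \<delta> > 0 \<longrightarrow>
        c * real n ^ (2 * k) \<le> 2 * real m \<longrightarrow>
        measure_pmf.prob (sample_pmf n m)
          {S. \<forall>f\<in>F. \<forall>g\<in>F.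
             true_error n g f \<le> empirical_error m S g f +
               sqrt ((c * real n ^ (2 * k) * ln (2 * exp 1 * real m / (c * real n ^ (2 * k)))
                      + 8 * ln (4 / \<delta>)) / real m)}
          \<ge> 1 - \<delta>)"
\<comment> \<open>With \<open>c = 2\<close> the hypothesis on \<open>m\<close> reads N \<le> m for N
  = \<open>n ^ (2 * k)\<close>, and the term 2N in \<open>E\<close> yields a factor exp(-4N), which
  cancels the bound exp(4N) on the number of pairs.\<close>
proof (intro exI[of _ 2] conjI allI impI)
  fix n k m :: nat and F :: "((nat \<Rightarrow> nat) \<Rightarrow> int) set" and \<delta> :: real
  assume "k \<le> n" and F: "F \<subseteq> cube n \<rightarrow>\<^sub>E {-1, 1}"
    and sens: "\<forall>f\<in>F. max_sensitivity n f \<le> k" and "\<delta> > 0"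
    and m: "2 * real n ^ (2 * k) \<le> 2 * real m"
  define N where "N = n ^ (2 * k)"
  define E where
    "E = 2 * real n ^ (2 * k) * ln (2 * exp 1 * real m / (2 * real n ^ (2 * k))) + 8 * ln (4 / \<delta>)"
  \<comment> \<open>If \<open>n = 0\<close>, then \<open>k \<le> n\<close> forces
    \<open>k = 0\<close>, and the power is 1.\<close>
  have N: "N \<ge> 1"
    using \<open>k \<le> n\<close> by (cases "n = 0") (auto simp: N_def)
  have Nm: "real N \<le> real m"
    using m by (simp add: N_def)
  then have "m > 0" using N by simp
  show "measure_pmf.prob (sample_pmf n m)
          {S. \<forall>f\<in>F. \<forall>g\<in>F. true_error n g f \<le> empirical_error m S g f +
               sqrt ((2 * real n ^ (2 * k) * ln (2 * exp 1 * real m / (2 * real n ^ (2 * k)))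
                      + 8 * ln (4 / \<delta>)) / real m)} \<ge> 1 - \<delta>"
  \<comment> \<open>For \<delta> \<ge> 1 the bound is trivial; this case is split off because a
    large \<delta> could make \<open>E\<close> negative.\<close>
  proof (cases "\<delta> < 1")
    case False
    then have "1 - \<delta> \<le> 0" by simp
    then show ?thesis
      using measure_nonneg order_trans by blast
  next
    case True
    have "exp 1 \<le> 2 * exp 1 * real m / (2 * real N)"
      using Nm N by (simp add: field_simps)
    then have ln1: "1 \<le> ln (2 * exp 1 * real m / (2 * real N))"
      by (subst ln_ge_iff) (use \<open>m > 0\<close> N in auto)
    have "2 * real N * 1 \<le> 2 * real N * ln (2 * exp 1 * real m / (2 * real N))"
      using ln1 by (intro mult_left_mono) auto
    moreover have "ln (1 / \<delta>) \<le> ln (4 / \<delta>)" "ln (1 / \<delta>) \<ge> 0"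
      using True \<open>\<delta> > 0\<close> by (auto simp: divide_simps)
    moreover have "E = 2 * real N * ln (2 * exp 1 * real m / (2 * real N)) + 8 * ln (4 / \<delta>)"
      by (simp add: E_def N_def)
    \<comment> \<open>Doubling \<open>E\<close> gives at least 4N + 16 ln(4/\<delta>), and
      ln(4/\<delta>) \<ge> ln(1/\<delta>) \<ge> 0.\<close>
    ultimately have E: "E \<ge> 0" "2 * E \<ge> 4 * real N + ln (1 / \<delta>)"
      by linarith+
    have "card F \<le> 2 ^ (N + 1)"
      unfolding N_def using F sens by (intro bounded_sensitivity_class_card) auto
    then have "real (card F) \<le> 2 ^ (N + 1)"
      using of_nat_le_iff[of "card F" "2 ^ (N + 1)", where ?'a = real] by simp
    \<comment> \<open>Since N \<ge> 1, the additive 1 is absorbed into a second N; then 2 \<le> e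
      turns the power into an exponential.\<close>
    also have "\<dots> \<le> 2 ^ (2 * N)"
      using N by (intro power_increasing) auto
    also have "\<dots> \<le> exp 1 ^ (2 * N)"
      using exp_ge_add_one_self[of 1] by (intro power_mono) auto
    also have "\<dots> = exp (2 * real N)"
      by (simp flip: exp_of_nat_mult)
    finally have "(real (card F))\<^sup>2 \<le> (exp (2 * real N))\<^sup>2"
      by (intro power_mono) auto
    also have "\<dots> = exp (4 * real N)"
      by (simp flip: exp_double)
    finally have "(real (card F))\<^sup>2 * exp (- 2 * E) \<le> exp (4 * real N) * exp (- 2 * E)"
      by (intro mult_right_mono) auto
    also have "\<dots> \<le> exp (- ln (1 / \<delta>))"
      using E(2) by (simp flip: exp_add)
    also have "\<dots> = \<delta>"
      using \<open>\<delta> > 0\<close> by (simp add: ln_div)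
    finally have "(real (card F))\<^sup>2 * exp (- 2 * E) \<le> \<delta>" .
    \<comment> \<open>The deviation t = \<open>sqrt (E / real m)\<close> turns the Hoeffding
      exponent into \<open>- 2 * E\<close>.\<close>
    moreover have "2 * real m * (sqrt (E / real m))\<^sup>2 = 2 * E"
      using E(1) \<open>m > 0\<close> by simp
    moreover have "finite F"
      using bounded_sensitivity_class_card(1)[OF F] sens by blast
    ultimately show ?thesis
      using uniform_deviation_bound[of F m "sqrt (E / real m)" n] E(1) \<open>m > 0\<close>
      unfolding E_def by simp
  qed
qed simp

end
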